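(* Let $A\in\mathbb{R}^{m\times c}$, $B\in\mathbb{R}^c$, and let $N_A\in\mathbb{R}^{c\times k}$ be a nullspace basis matrix of $A$. Let $\mathcal{N}=\{\mu\in\mathbb{R}^k\mid N_A\mu\ge 0\}$ and let $\mathcal{N}_C=\{\nu\in\mathbb{R}^k\mid \nu^\top\mu\le 0,\ \forall\mu\in\mathcal{N}\}$ be its polar cone. The maximum of the linear program $$\max_{\mu\in\mathbb{R}^k}\ \{-B^\top N_A\mu\}\quad\text{s.t.}\quad N_A\mu\ge 0$$ is bounded if and only if $-B_A\in\mathcal{N}_C$, where $B_A= N_A^\top B$.
   Context: Vector inequalities are element-wise. A nullspace basis matrix of $A$ is a matrix $N_A\in\mathbb{R}^{c\times k}$, $k=\dim\ker A$, whose columns form a basis of $\{\lambda\in\mathbb{R}^c\mid A\lambda=0\}$. The maximum is bounded if the objective is bounded from above on the feasible set (supremum $<\infty$). *)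

theory Defs
  imports Complex_Main "Jordan_Normal_Form.Matrix_Kernel"
begin

(* Carrier-based matrices and vectors are used so that all dimensions, including the
   kernel dimension, may be 0. *)

(* distinct is needed because set (cols N) forgets repeated columns. *)
definition nullspace_basis_mat :: "real mat \<Rightarrow> real mat \<Rightarrow> bool" where
  "nullspace_basis_mat A N \<longleftrightarrow>
     N \<in> carrier_mat (dim_col A) (kernel.dim (dim_col A) A) \<and>
     distinct (cols N) \<and> kernel.basis (dim_col A) A (set (cols N))"

(* The order on vectors is the library's component-wise order, which also requires
   both sides to have the same dimension. *)
definition nonneg_cone :: "real mat \<Rightarrow> real vec set" where
  "nonneg_cone N = {\<mu> \<in> carrier_vec (dim_col N). N *\<^sub>v \<mu> \<ge> 0\<^sub>v (dim_row N)}"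

definition polar_cone :: "nat \<Rightarrow> real vec set \<Rightarrow> real vec set" where
  "polar_cone k S = {\<nu> \<in> carrier_vec k. \<forall>\<mu>\<in>S. \<nu> \<bullet> \<mu> \<le> 0}"

end

theory Submission
  imports Defs
begin

text \<open>The feasible set is a cone and the objective is linear. On a set closed under
  nonnegative scaling, a homogeneous function is bounded above exactly when it is never positive,
  since one positive value could be scaled past any bound. Moving the matrix across the inner
  product writes the objective as \<open>\<nu> \<bullet> \<mu>\<close> with
  \<open>\<nu> = - (N\<^sub>A\<^sup>T *\<^sub>v B)\<close>, and nonpositivity of this on the cone is
  membership of \<open>\<nu>\<close> in the polar cone.\<close>

lemma scaleable_bdd_above_iff_nonpos:
  fixes f :: "'a \<Rightarrow> real"
  assumes scale: "\<And>x t. x \<in> S \<Longrightarrow> t \<ge> 0 \<Longrightarrow> \<exists>y\<in>S. f y = t * f x"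
  shows "bdd_above (f ` S) \<longleftrightarrow> (\<forall>x\<in>S. f x \<le> 0)"
proof
  assume "bdd_above (f ` S)"
  then obtain M where M: "\<And>x. x \<in> S \<Longrightarrow> f x \<le> M"
    by (auto simp: bdd_above_def)
  show "\<forall>x\<in>S. f x \<le> 0"
  proof (intro ballI, rule ccontr)
    fix x assume x: "x \<in> S" "\<not> f x \<le> 0"
    \<comment> \<open>The factor rescales the positive value \<open>f x\<close> to
      \<open>\<bar>M\<bar> + 1\<close>, which exceeds \<open>M\<close>; the absolute value keeps the
      factor nonnegative even if \<open>M\<close> is negative.\<close>
    then obtain y where "y \<in> S" "f y = (\<bar>M\<bar> + 1) / f x * f x"
      using scale[of x "(\<bar>M\<bar> + 1) / f x"] by auto
    with x M[of y] show False by simp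
  qed
qed (auto intro: bdd_aboveI2)

lemma smult_nonneg_cone:
  assumes "\<mu> \<in> nonneg_cone N" "t \<ge> 0"
  shows "t \<cdot>\<^sub>v \<mu> \<in> nonneg_cone N"
proof -
  have "N *\<^sub>v (t \<cdot>\<^sub>v \<mu>) = t \<cdot>\<^sub>v (N *\<^sub>v \<mu>)"
    using assms(1) by (intro mult_mat_vec) (auto simp: nonneg_cone_def)
  with assms show ?thesis
    by (auto simp: nonneg_cone_def less_eq_vec_def)
qed

text \<open>The transpose is the adjoint for the scalar product; this exposes the coefficient vector
  of the objective as a functional of \<open>\<mu>\<close>.\<close>

lemma uminus_transpose_mult_scalar_prod:
  fixes N :: "real mat"
  assumes "N \<in> carrier_mat n k" "v \<in> carrier_vec n" "\<mu> \<in> carrier_vec k"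
  shows "(- (N\<^sup>T *\<^sub>v v)) \<bullet> \<mu> = - (v \<bullet> (N *\<^sub>v \<mu>))"
  using assms transpose_vec_mult_scalar[OF assms(1,3,2)] by simp

theorem proposition2:
  fixes A N\<^sub>A :: "real mat" and B :: "real vec" and m c k :: nat
  assumes "A \<in> carrier_mat m c"
    and "B \<in> carrier_vec c"
    and "N\<^sub>A \<in> carrier_mat c k"
    and "nullspace_basis_mat A N\<^sub>A"
  shows "bdd_above ((\<lambda>\<mu>. - (B \<bullet> (N\<^sub>A *\<^sub>v \<mu>))) ` {\<mu> \<in> carrier_vec k. N\<^sub>A *\<^sub>v \<mu> \<ge> 0\<^sub>v c})
     \<longleftrightarrow> - (N\<^sub>A\<^sup>T *\<^sub>v B) \<in> polar_cone k (nonneg_cone N\<^sub>A)"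
proof -
  let ?\<nu> = "- (N\<^sub>A\<^sup>T *\<^sub>v B)"
  have cone: "{\<mu> \<in> carrier_vec k. N\<^sub>A *\<^sub>v \<mu> \<ge> 0\<^sub>v c} = nonneg_cone N\<^sub>A"
    using assms(3) by (auto simp: nonneg_cone_def)
  have \<nu>: "?\<nu> \<in> carrier_vec k"
    using assms(2,3) by simp
  \<comment> \<open>Restricted to the cone because adjointness is applied to vectors of dimension
    \<open>k\<close>, which cone membership guarantees.\<close>
  have obj: "- (B \<bullet> (N\<^sub>A *\<^sub>v \<mu>)) = ?\<nu> \<bullet> \<mu>" and dim: "\<mu> \<in> carrier_vec k"
    if "\<mu> \<in> nonneg_cone N\<^sub>A" for \<mu>
    using that assms(3) uminus_transpose_mult_scalar_prod[OF assms(3,2), of \<mu>]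
    by (auto simp: nonneg_cone_def)
  have "(\<lambda>\<mu>. - (B \<bullet> (N\<^sub>A *\<^sub>v \<mu>))) ` nonneg_cone N\<^sub>A = (\<lambda>\<mu>. ?\<nu> \<bullet> \<mu>) ` nonneg_cone N\<^sub>A"
    by (rule image_cong[OF refl obj])
  moreover have "bdd_above ((\<lambda>\<mu>. ?\<nu> \<bullet> \<mu>) ` nonneg_cone N\<^sub>A) \<longleftrightarrow> (\<forall>\<mu>\<in>nonneg_cone N\<^sub>A. ?\<nu> \<bullet> \<mu> \<le> 0)"
  proof (rule scaleable_bdd_above_iff_nonpos)
    fix \<mu> and t :: real assume "\<mu> \<in> nonneg_cone N\<^sub>A" "t \<ge> 0"
    then show "\<exists>\<mu>'\<in>nonneg_cone N\<^sub>A. ?\<nu> \<bullet> \<mu>' = t * (?\<nu> \<bullet> \<mu>)"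
      using smult_nonneg_cone scalar_prod_smult_distrib[OF \<nu> dim]
      by (intro bexI[of _ "t \<cdot>\<^sub>v \<mu>"]) auto
  qed
  \<comment> \<open>The sign condition is the polar inequality; \<open>\<nu>\<close> supplies the
    dimension part of \<open>polar_cone\<close>.\<close>
  ultimately show ?thesis
    using \<nu> by (simp add: cone polar_cone_def)
qed

end
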